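(* For every integer $n\ge 3$, let $K_n$ be the complete graph on $n$ vertices and let $Sp(K_n)$ be its splitting graph. Then $$\gamma_{ds}(Sp(K_n))=4.$$
   Context: All graphs are finite, simple and undirected. A set $S\subseteq V(G)$ is a dual-server dominating set (DS-dominating set) of a graph $G$ if there is a partition $\{R,B\}$ of $S$ such that every vertex of $V(G)\setminus S$ has at least one neighbour in $R$ and at least one neighbour in $B$. The dual-server domination number $\gamma_{ds}(G)$ is the minimum cardinality of a DS-dominating set of $G$. The splitting graph $Sp(G)$ of $G$ is obtained from $G$ by adding, for each vertex $v\in V(G)$, a new vertex $v'$ (the twin of $v$) adjacent exactly to the vertices of the open neighbourhood $N_G(v)$ of $v$ in $G$ (so twins are pairwise nonadjacent, and $v'$ is not adjacent to $v$). *)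

theory Defs
  imports "HOL-Library.Disjoint_Sets" "Graph_Theory.Graph_Theory"
begin

text \<open>
  A finite simple undirected graph is a \<open>pair_graph\<close>: an undirected edge \<open>uv\<close> is represented
  by the two arcs \<open>(u, v)\<close> and \<open>(v, u)\<close>.
\<close>

text \<open>
  \<open>Inl v\<close> is the original vertex \<open>v\<close> and \<open>Inr v\<close> is its twin.
\<close>

definition splitting_graph :: "'a pair_pre_digraph \<Rightarrow> ('a + 'a) pair_pre_digraph" where
  "splitting_graph G = \<lparr>
     pverts = pverts G <+> pverts G,
     parcs = {(Inl u, Inl v) | u v. (u, v) \<in> parcs G}
           \<union> {(Inr u, Inl v) | u v. (u, v) \<in> parcs G}
           \<union> {(Inl u, Inr v) | u v. (u, v) \<in> parcs G} \<rparr>"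

lemma pair_graph_splitting_graph:
  assumes "pair_graph G"
  shows "pair_graph (splitting_graph G)"
proof -
  interpret pair_graph G by fact
  let ?a = "\<lambda>f g. (\<lambda>(u, v). (f u, g v)) ` parcs G"
  have arcs: "parcs (splitting_graph G) = ?a Inl Inl \<union> ?a Inr Inl \<union> ?a Inl Inr"
    by (force simp: splitting_graph_def)
  have loop: "u \<noteq> v" if "(u, v) \<in> parcs G" for u v
    using pair_no_loops[OF that] by simp
  have sy: "(v, u) \<in> parcs G" if "(u, v) \<in> parcs G" for u v
    using pair_sym_arcs that by (auto simp: symmetric_def sym_def)
  show ?thesis
  proof
    show "finite (parcs (splitting_graph G))"
      unfolding arcs using pair_finite_arcs by blast
    show "symmetric (with_proj (splitting_graph G))"
      by (auto simp: symmetric_def sym_def splitting_graph_def intro: sy)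
  qed (auto simp: splitting_graph_def pair_finite_verts dest: loop in_arcsD1 in_arcsD2)
qed

text \<open>
  \<open>R \<noteq> B\<close> is needed because \<open>partition_on S {S}\<close> holds for every nonempty \<open>S\<close>, and
  \<open>{S, S} = {S}\<close>. As usual for partitions, both blocks are nonempty; when some vertex lies
  outside \<open>S\<close> this already follows from the domination condition.
\<close>

definition ds_dominating :: "'a pair_pre_digraph \<Rightarrow> 'a set \<Rightarrow> bool" where
  "ds_dominating G S \<longleftrightarrow> S \<subseteq> pverts G \<and>
     (\<exists>R B. R \<noteq> B \<and> partition_on S {R, B} \<and>
        (\<forall>v \<in> pverts G - S. (\<exists>r \<in> R. (v, r) \<in> parcs G) \<and> (\<exists>b \<in> B. (v, b) \<in> parcs G)))"

text \<open>
  The minimum exists for every finite graph with at least two vertices, since then the whole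
  vertex set is DS-dominating.
\<close>

definition ds_domination_number :: "'a pair_pre_digraph \<Rightarrow> nat" (\<open>\<gamma>\<^sub>d\<^sub>s\<close>) where
  "\<gamma>\<^sub>d\<^sub>s G = (LEAST k. \<exists>S. ds_dominating G S \<and> card S = k)"

end

theory Submission
  imports Defs
begin

text \<open>
  Two vertices \<open>a \<noteq> b\<close> of the complete graph together with their twins form a
  DS-dominating set of size 4, with classes \<open>{a, a'}\<close> and \<open>{b, b'}\<close>: every
  other vertex and every other twin is adjacent to both \<open>a\<close> and \<open>b\<close>.

  For the lower bound, let \<open>A\<close> and \<open>T\<close> be the sets of those \<open>v\<close>
  for which \<open>v\<close>, respectively the twin \<open>v'\<close>, lies in the DS-dominating set
  \<open>S = R \<union> B\<close>. A twin \<open>v'\<close> outside \<open>S\<close> has only original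
  vertices other than \<open>v\<close> as neighbours, so \<open>A - {v}\<close> meets both classes. Hence
  if \<open>A\<close> has at most one element, all \<open>n \<ge> 3\<close> twins are in
  \<open>S\<close>; if \<open>A\<close> has exactly two elements, the twins of both are in
  \<open>S\<close>. The only sets \<open>S\<close> of size at most three that survive this count consist
  of three originals or of three twins. Both are excluded by pigeonhole: a set that still meets both
  classes after the removal of any one of its elements has at least two elements in each class
  (\<open>card_ge_4_if_two_colours_robust\<close>).
\<close>

lemma complete_digraph_with_projD:
  assumes "K\<^bsub>n\<^esub> (with_proj G)"
  shows "finite (pverts G)" "card (pverts G) = n"
    and "(u, v) \<in> parcs G \<longleftrightarrow> u \<in> pverts G \<and> v \<in> pverts G \<and> u \<noteq> v"
  using assms by (auto simp: complete_digraph_pair_def)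

lemma pverts_splitting_graph [simp]:
  "pverts (splitting_graph G) = pverts G <+> pverts G"
  by (simp add: splitting_graph_def)

lemma parcs_splitting_graph [simp]:
  "(Inl u, Inl v) \<in> parcs (splitting_graph G) \<longleftrightarrow> (u, v) \<in> parcs G"
  "(Inr u, Inl v) \<in> parcs (splitting_graph G) \<longleftrightarrow> (u, v) \<in> parcs G"
  "(Inl u, Inr v) \<in> parcs (splitting_graph G) \<longleftrightarrow> (u, v) \<in> parcs G"
  "(Inr u, Inr v) \<notin> parcs (splitting_graph G)"
  by (auto simp: splitting_graph_def)

lemma card_ge_4_if_two_colours_robust:
  assumes "finite X" "X \<noteq> {}" and disj: "R \<inter> B = {}"
    and robust: "\<And>x. x \<in> X \<Longrightarrow> (\<exists>r \<in> X \<inter> R. r \<noteq> x) \<and> (\<exists>b \<in> X \<inter> B. b \<noteq> x)"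
  shows "card X \<ge> 4"
proof -
  obtain r b where r: "r \<in> X \<inter> R" and b: "b \<in> X \<inter> B"
    using robust \<open>X \<noteq> {}\<close> by blast
  obtain r' where r': "r' \<in> X \<inter> R" "r' \<noteq> r"
    using robust r by blast
  obtain b' where b': "b' \<in> X \<inter> B" "b' \<noteq> b"
    using robust b by blast
  have "distinct [r, r', b, b']"
    using r r' b b' disj by auto
  then have "card {r, r', b, b'} = 4"
    using distinct_card by fastforce
  moreover have "card {r, r', b, b'} \<le> card X"
    using r r' b b' by (intro card_mono \<open>finite X\<close>) auto
  ultimately show ?thesis
    by simp
qed

lemma ds_dominating_splitting_complete:
  assumes "K\<^bsub>n\<^esub> (with_proj G)" and "a \<in> pverts G" "b \<in> pverts G" "a \<noteq> b"
  shows "ds_dominating (splitting_graph G) {Inl a, Inr a, Inl b, Inr b}"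
proof -
  note arcs = complete_digraph_with_projD(3)[OF assms(1)]
  have "partition_on {Inl a, Inr a, Inl b, Inr b} {{Inl a, Inr a}, {Inl b, Inr b}}"
    using assms(4) by (auto simp: partition_on_def disjoint_def)
  moreover have "{Inl a, Inr a} \<noteq> {Inl b, Inr b}"
    using assms(4) by blast
  ultimately show ?thesis
    unfolding ds_dominating_def using assms(2-4)
    by (intro conjI exI[of _ "{Inl a, Inr a}"] exI[of _ "{Inl b, Inr b}"]) (auto simp: arcs)
qed

lemma card_ge_4_if_ds_dominating_splitting_complete:
  assumes "n \<ge> 3" and K: "K\<^bsub>n\<^esub> (with_proj G)"
    and "ds_dominating (splitting_graph G) S"
  shows "card S \<ge> 4"
proof -
  let ?V = "pverts G"
  note arcs = complete_digraph_with_projD(3)[OF K]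
  obtain R B where S: "S \<subseteq> ?V <+> ?V" and "R \<noteq> B" and part: "partition_on S {R, B}"
    and dom: "\<And>v. v \<in> (?V <+> ?V) - S \<Longrightarrow>
      (\<exists>r \<in> R. (v, r) \<in> parcs (splitting_graph G)) \<and>
      (\<exists>b \<in> B. (v, b) \<in> parcs (splitting_graph G))"
    using assms(3) unfolding ds_dominating_def pverts_splitting_graph by blast
  have RB: "S = R \<union> B" and disj: "R \<inter> B = {}"
    using part \<open>R \<noteq> B\<close> by (auto simp: partition_on_def disjoint_def)
  define A where "A = {v. Inl v \<in> S}"
  define T where "T = {v. Inr v \<in> S}"
  have sub: "A \<subseteq> ?V" "T \<subseteq> ?V"
    using S by (auto simp: A_def T_def)
  have fin: "finite A" "finite T"
    using sub complete_digraph_with_projD(1)[OF K] finite_subset by auto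
  have "S = A <+> T"
  proof (rule set_eqI)
    show "x \<in> S \<longleftrightarrow> x \<in> A <+> T" for x
      by (cases x) (auto simp: A_def T_def)
  qed
  then have card_S: "card S = card A + card T"
    using fin by (simp add: card_Plus)
  have twin: "(\<exists>r \<in> A \<inter> Inl -` R. r \<noteq> v) \<and> (\<exists>b \<in> A \<inter> Inl -` B. b \<noteq> v)"
    if "v \<in> ?V - T" for v
  proof -
    from that have "Inr v \<in> (?V <+> ?V) - S"
      by (auto simp: T_def)
    from dom[OF this] obtain r b where rb: "r \<in> R" "(Inr v, r) \<in> parcs (splitting_graph G)"
        "b \<in> B" "(Inr v, b) \<in> parcs (splitting_graph G)"
      by blast
    then show ?thesis
      by (cases r; cases b) (auto simp: arcs A_def RB)
  qed
  have two: "\<exists>r \<in> A. \<exists>b \<in> A. r \<noteq> b \<and> r \<noteq> v \<and> b \<noteq> v" if v: "v \<in> ?V - T" for v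
  proof -
    obtain r b where rb: "r \<in> A" "Inl r \<in> R" "r \<noteq> v" "b \<in> A" "Inl b \<in> B" "b \<noteq> v"
      using twin[OF v] by auto
    then have "r \<noteq> b"
      using disj by auto
    with rb show ?thesis
      by blast
  qed
  consider "card A = 0" | "card A = 1" | "card A = 2" | "card A = 3" | "card A \<ge> 4"
    by linarith
  then show ?thesis
  proof cases
    case 1
    then have "A = {}"
      using fin by simp
    then have "T = ?V"
      using two sub by blast
    \<comment> \<open>The neighbours of an original \<open>v\<close> inside \<open>S\<close> are now the twins of the other vertices.\<close>
    have "card T \<ge> 4"
    proof (rule card_ge_4_if_two_colours_robust)
      show "T \<noteq> {}"
        using \<open>T = ?V\<close> complete_digraph_with_projD(2)[OF K] \<open>n \<ge> 3\<close> by auto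
      show "Inr -` R \<inter> Inr -` B = {}"
        using disj by auto
      show "(\<exists>r \<in> T \<inter> Inr -` R. r \<noteq> v) \<and> (\<exists>b \<in> T \<inter> Inr -` B. b \<noteq> v)" if "v \<in> T" for v
      proof -
        have "Inl v \<in> (?V <+> ?V) - S"
          using that sub \<open>A = {}\<close> by (auto simp: A_def)
        from dom[OF this] obtain x y where xy: "x \<in> R" "(Inl v, x) \<in> parcs (splitting_graph G)"
            "y \<in> B" "(Inl v, y) \<in> parcs (splitting_graph G)"
          by blast
        have "Inl w \<notin> R \<and> Inl w \<notin> B" for w
          using \<open>A = {}\<close> by (auto simp: A_def RB)
        with xy(1,3) obtain r b where "x = Inr r" "y = Inr b"
          by (metis sumE)
        with xy have "r \<in> T \<inter> Inr -` R" "r \<noteq> v" "b \<in> T \<inter> Inr -` B" "b \<noteq> v"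
          by (auto simp: arcs T_def RB)
        then show ?thesis
          by blast
      qed
    qed (fact fin)
    then show ?thesis
      using card_S by simp
  next
    case 2
    then obtain a where "A = {a}"
      by (auto simp: card_1_singleton_iff)
    then have "T = ?V"
      using two sub by blast
    then show ?thesis
      using complete_digraph_with_projD(2)[OF K] \<open>n \<ge> 3\<close> card_S 2 by simp
  next
    case 3
    then obtain a b where "A = {a, b}"
      by (auto simp: card_2_iff)
    then have "A \<subseteq> T"
      using two sub by blast
    then have "card A \<le> card T"
      by (rule card_mono[OF fin(2)])
    then show ?thesis
      using card_S 3 by simp
  next
    case 4
    show ?thesis
    proof (cases "T = {}")
      case True
      have "card A \<ge> 4"
      proof (rule card_ge_4_if_two_colours_robust)
        show "A \<noteq> {}"
          using 4 by auto
        show "Inl -` R \<inter> Inl -` B = {}"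
          using disj by auto
        show "(\<exists>r \<in> A \<inter> Inl -` R. r \<noteq> v) \<and> (\<exists>b \<in> A \<inter> Inl -` B. b \<noteq> v)" if "v \<in> A" for v
          using twin that sub True by blast
      qed (fact fin)
      then show ?thesis
        using card_S by simp
    next
      case False
      then have "card T > 0"
        using fin by (simp add: card_gt_0_iff)
      then show ?thesis
        using card_S 4 by simp
    qed
  next
    case 5
    then show ?thesis
      using card_S by simp
  qed
qed

theorem theorem2p4:
  fixes n :: nat and G :: "'a pair_pre_digraph"
  assumes "n \<ge> 3" and "K\<^bsub>n\<^esub> (with_proj G)"
  shows "\<gamma>\<^sub>d\<^sub>s (splitting_graph G) = 4"
  unfolding ds_domination_number_def
proof (rule Least_equality)
  have "2 \<le> card (pverts G)"
    using assms complete_digraph_with_projD(2) by fastforce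
  then obtain X where "X \<subseteq> pverts G" "card X = 2"
    using obtain_subset_with_card_n by metis
  then obtain a b where ab: "a \<in> pverts G" "b \<in> pverts G" "a \<noteq> b"
    by (auto simp: card_2_iff)
  have "card {Inl a, Inr a, Inl b, Inr b} = 4"
    using ab by simp
  with ds_dominating_splitting_complete[OF assms(2) ab]
  show "\<exists>S. ds_dominating (splitting_graph G) S \<and> card S = 4"
    by (intro exI conjI)
next
  show "4 \<le> k" if "\<exists>S. ds_dominating (splitting_graph G) S \<and> card S = k" for k
    using that card_ge_4_if_ds_dominating_splitting_complete[OF assms] by auto
qed

end
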